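(* Let $0<t\le1$, let $\mathbf n=(n_k)_{k\in\mathbb N}$ be a strictly increasing sequence of positive integers, and let $\mathcal B=(\mathbf e_i)_{i\in\mathbb N}$ be a semi-normalized Markushevich basis for a quasi-Banach space $\mathbb X$. The following are equivalent: (i) There is $\mathbf C_1>0$ such that for all $x\in\mathbb X$, if $A$ is a $t$-greedy set for $x$ with $|A|\in\mathbf n$, then $\|P_A(x)\|\le\mathbf C_1\|x\|$. (ii) There is $\mathbf C_2>0$ such that for all $x\in\mathbb X$ with finite support, if $A$ is a $t$-greedy set for $x$ with $|A|\in\mathbf n$, then $\|P_A(x)\|\le\mathbf C_2\|x\|$. (iii) There are $m\in\mathbb N$ and $\mathbf C_3>0$ such that for all $x\in\mathbb X$ with finite support, if $m<\operatorname{supp}(x)$ and $A$ is a $t$-greedy set for $x$ with $|A|\in\mathbf n$, then $\|P_A(x)\|\le\mathbf C_3\|x\|$. (iv) For each $x\in\mathbb X$ there is $\mathbf C_4(x)>0$ such that if $A$ is a $t$-greedy set for $x$ and $|A|\in\mathbf n$, then $\|P_A(x)\|\le\mathbf C_4(x)$. (v) For any $x\in\mathbb X$ and any choice of $t$-greedy sums $\mathbf G^t_{n_i}(x)$ ($i\in\mathbb N$), $\lim_{i}\mathbf G^t_{n_i}(x)=x$.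
   Context: A semi-normalized Markushevich basis of the (separable, infinite-dimensional, real or complex) quasi-Banach space $\mathbb X$ is a sequence $(\mathbf e_i)_{i\in\mathbb N}\subset\mathbb X$ with dense linear span, for which there is a (unique) sequence of continuous linear functionals $(\mathbf e_i^* )_{i\in\mathbb N}\subset\mathbb X^*$ with $\mathbf e_k^*(\mathbf e_i)=\delta_{k,i}$, such that $\mathbf e_i^*(x)=0$ for all $i$ implies $x=0$, and $\sup_i\{\|\mathbf e_i\|,\|\mathbf e_i^*\|\}<\infty$. $\operatorname{supp}(x)=\{i\in\mathbb N:\mathbf e_i^*(x)\ne0\}$; $m<\operatorname{supp}(x)$ means $m<i$ for every $i\in\operatorname{supp}(x)$. For a finite set $A\subset\mathbb N$, $P_A(x)=\sum_{i\in A}\mathbf e_i^*(x)\mathbf e_i$. For $0<t\le1$, a finite set $A\subset\mathbb N$ is a $t$-greedy set for $x\in\mathbb X$ if $\min_{i\in A}|\mathbf e_i^*(x)|\ge t\max_{i\notin A}|\mathbf e_i^*(x)|$, i.e. $|\mathbf e_i^*(x)|\ge t|\mathbf e_j^*(x)|$ for all $i\in A$, $j\notin A$. A $t$-greedy sum $\mathbf G^t_m(x)$ is a vector $P_A(x)$ where $A$ is a $t$-greedy set for $x$ with $|A|=m$. $|A|\in\mathbf n$ means $|A|=n_k$ for some $k$. *)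

theory Defs
  imports "HOL-Analysis.Analysis"
begin

text \<open>The balls of a quasi-norm need not be open, so the topology is given by its open sets.\<close>

definition qnorm_topology :: "('a::ab_group_add \<Rightarrow> real) \<Rightarrow> 'a topology" where
  "qnorm_topology N = topology (\<lambda>U. \<forall>x\<in>U. \<exists>r>0. {y. N (y - x) < r} \<subseteq> U)"

lemma openin_qnorm_topology:
  "openin (qnorm_topology N) U \<longleftrightarrow> (\<forall>x\<in>U. \<exists>r>0. {y. N (y - x) < r} \<subseteq> U)"
proof -
  have "istopology (\<lambda>U. \<forall>x\<in>U. \<exists>r>0. {y. N (y - x) < r} \<subseteq> U)"
    unfolding istopology_def
  proof (intro conjI allI impI ballI)
    fix S T x
    assume S: "\<forall>x\<in>S. \<exists>r>0. {y. N (y - x) < r} \<subseteq> S"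
      and T: "\<forall>x\<in>T. \<exists>r>0. {y. N (y - x) < r} \<subseteq> T" and x: "x \<in> S \<inter> T"
    obtain r s where "r > 0" "{y. N (y - x) < r} \<subseteq> S" "s > 0" "{y. N (y - x) < s} \<subseteq> T"
      using S T x by blast
    then show "\<exists>r>0. {y. N (y - x) < r} \<subseteq> S \<inter> T"
      by (intro exI[of _ "min r s"]) auto
  next
    fix \<K> x
    assume K: "\<forall>K\<in>\<K>. \<forall>x\<in>K. \<exists>r>0. {y. N (y - x) < r} \<subseteq> K" and x: "x \<in> \<Union>\<K>"
    then obtain K where "K \<in> \<K>" "x \<in> K" by blast
    with K obtain r where "r > 0" "{y. N (y - x) < r} \<subseteq> K" by blast
    with \<open>K \<in> \<K>\<close> show "\<exists>r>0. {y. N (y - x) < r} \<subseteq> \<Union>\<K>" by blast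
  qed
  then show ?thesis
    unfolding qnorm_topology_def by simp
qed

text \<open>
  Real and complex spaces are treated at once: the scalar field is any type of class
  \<^class>\<open>real_normed_field\<close>, which includes \<^typ>\<open>real\<close> and \<^typ>\<open>complex\<close> (and, by the
  Gelfand--Mazur theorem, nothing else up to isomorphism).
\<close>

locale quasi_banach_space = vector_space smul
  for smul :: "'k::real_normed_field \<Rightarrow> 'a::ab_group_add \<Rightarrow> 'a" +
  fixes qnorm :: "'a \<Rightarrow> real"
  assumes qnorm_nonneg: "qnorm x \<ge> 0"
    and qnorm_eq_0_iff: "qnorm x = 0 \<longleftrightarrow> x = 0"
    and qnorm_scale: "qnorm (smul a x) = norm a * qnorm x"
    and quasi_triangle: "\<exists>\<kappa>\<ge>1. \<forall>x y. qnorm (x + y) \<le> \<kappa> * (qnorm x + qnorm y)"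
    and complete: "(\<forall>\<epsilon>>0. \<exists>M. \<forall>m\<ge>M. \<forall>n\<ge>M. qnorm (X m - X n) < \<epsilon>) \<Longrightarrow>
                     \<exists>x. limitin (qnorm_topology qnorm) X x sequentially"
begin

lemma limitin_qnorm_topology:
  "limitin (qnorm_topology qnorm) X x sequentially \<longleftrightarrow> (\<lambda>n. qnorm (X n - x)) \<longlonglongrightarrow> 0"
proof
  assume L: "limitin (qnorm_topology qnorm) X x sequentially"
  obtain \<kappa> where \<kappa>: "\<kappa> \<ge> 1" "\<And>x y. qnorm (x + y) \<le> \<kappa> * (qnorm x + qnorm y)"
    using quasi_triangle by blast
  show "(\<lambda>n. qnorm (X n - x)) \<longlonglongrightarrow> 0"
  proof (rule LIMSEQ_I)
    fix r :: real assume r: "r > 0"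
    define B where "B y s = {z. qnorm (z - y) < s}" for y s
    define U where "U = {y. \<exists>s>0. B y s \<subseteq> B x r}"
    have "openin (qnorm_topology qnorm) U"
      unfolding openin_qnorm_topology
    proof
      fix y assume "y \<in> U"
      then obtain s where s: "s > 0" "B y s \<subseteq> B x r" unfolding U_def by blast
      have "B z (s / (2 * \<kappa>)) \<subseteq> B x r" if z: "z \<in> B y (s / (2 * \<kappa>))" for z
      proof
        fix w assume w: "w \<in> B z (s / (2 * \<kappa>))"
        have "qnorm (w - y) \<le> \<kappa> * (qnorm (w - z) + qnorm (z - y))"
          using \<kappa>(2)[of "w - z" "z - y"] by simp
        also have "\<dots> < \<kappa> * (s / (2 * \<kappa>) + s / (2 * \<kappa>))"
          using w z \<kappa>(1) unfolding B_def by (intro mult_strict_left_mono) auto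
        also have "\<dots> = s" using \<kappa>(1) by (simp add: field_simps)
        finally show "w \<in> B x r" using s(2) unfolding B_def by blast
      qed
      then have "B y (s / (2 * \<kappa>)) \<subseteq> U"
        using s(1) \<kappa>(1) unfolding U_def by (auto intro!: exI[of _ "s / (2 * \<kappa>)"])
      then show "\<exists>t>0. {z. qnorm (z - y) < t} \<subseteq> U"
        using s(1) \<kappa>(1) unfolding B_def by (intro exI[of _ "s / (2 * \<kappa>)"]) auto
    qed
    moreover have "x \<in> U" using r unfolding U_def by auto
    ultimately have "\<forall>\<^sub>F n in sequentially. X n \<in> U"
      using L unfolding limitin_def by blast
    moreover have "U \<subseteq> B x r"
      using qnorm_eq_0_iff[of 0] unfolding U_def B_def by force
    ultimately have "\<forall>\<^sub>F n in sequentially. qnorm (X n - x) < r"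
      unfolding B_def by (auto elim!: eventually_mono)
    then show "\<exists>M. \<forall>n\<ge>M. norm (qnorm (X n - x) - 0) < r"
      using qnorm_nonneg by (auto simp: eventually_sequentially)
  qed
next
  assume L: "(\<lambda>n. qnorm (X n - x)) \<longlonglongrightarrow> 0"
  have "openin (qnorm_topology qnorm) UNIV"
    unfolding openin_qnorm_topology by (auto intro: exI[of _ 1])
  then have "x \<in> topspace (qnorm_topology qnorm)"
    using openin_subset by blast
  moreover have "\<forall>\<^sub>F n in sequentially. X n \<in> U"
    if "openin (qnorm_topology qnorm) U" "x \<in> U" for U
  proof -
    obtain r where r: "r > 0" "{y. qnorm (y - x) < r} \<subseteq> U"
      using \<open>openin (qnorm_topology qnorm) U\<close> \<open>x \<in> U\<close> unfolding openin_qnorm_topology by blast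
    have "\<forall>\<^sub>F n in sequentially. qnorm (X n - x) < r"
      using L r(1) by (rule order_tendstoD)
    then show ?thesis by (rule eventually_mono) (use r(2) in blast)
  qed
  ultimately show "limitin (qnorm_topology qnorm) X x sequentially"
    unfolding limitin_def by blast
qed

end

text \<open>
  The functional norm. On a continuous linear functional the supremum is over a nonempty bounded
  set of reals; elsewhere the value is not meaningful.
\<close>

definition dual_qnorm :: "('a \<Rightarrow> real) \<Rightarrow> ('a \<Rightarrow> 'k::real_normed_field) \<Rightarrow> real" where
  "dual_qnorm N f = (SUP x\<in>{x. N x \<le> 1}. norm (f x))"

text \<open>
  The basis is indexed by \<^typ>\<open>nat\<close>, so its first vector is \<open>e 0\<close>. The coordinate functionals
  \<open>e'\<close> are determined by \<open>e\<close> (biorthogonality, continuity and density), hence carrying them as a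
  parameter is the same as asserting their existence. Such a basis is linearly
  independent with dense span, so the space is automatically infinite-dimensional and separable.
\<close>

locale semi_normalized_M_basis = quasi_banach_space smul qnorm
  for smul :: "'k::real_normed_field \<Rightarrow> 'a::ab_group_add \<Rightarrow> 'a" and qnorm :: "'a \<Rightarrow> real" +
  fixes e :: "nat \<Rightarrow> 'a" and e' :: "nat \<Rightarrow> 'a \<Rightarrow> 'k"
  assumes dense_span: "qnorm_topology qnorm closure_of span (range e) = UNIV"
    and coord_linear: "Vector_Spaces.linear smul (*) (e' i)"
    and coord_continuous: "continuous_map (qnorm_topology qnorm) euclidean (e' i)"
    and biorthogonal: "e' k (e i) = (if k = i then 1 else 0)"
    and total: "(\<And>i. e' i x = 0) \<Longrightarrow> x = 0"
    and basis_bounded: "bdd_above (range (\<lambda>i. qnorm (e i)))"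
    and coord_bounded: "bdd_above (range (\<lambda>i. dual_qnorm qnorm (e' i)))"

definition supp :: "(nat \<Rightarrow> 'a \<Rightarrow> 'k::zero) \<Rightarrow> 'a \<Rightarrow> nat set" where
  "supp e' x = {i. e' i x \<noteq> 0}"

definition coord_proj ::
  "('k \<Rightarrow> 'a \<Rightarrow> 'a) \<Rightarrow> (nat \<Rightarrow> 'a) \<Rightarrow> (nat \<Rightarrow> 'a \<Rightarrow> 'k) \<Rightarrow> nat set \<Rightarrow> 'a \<Rightarrow> 'a::comm_monoid_add" where
  "coord_proj smul e e' A x = (\<Sum>i\<in>A. smul (e' i x) (e i))"

definition greedy_set ::
  "(nat \<Rightarrow> 'a \<Rightarrow> 'k::real_normed_field) \<Rightarrow> real \<Rightarrow> 'a \<Rightarrow> nat set \<Rightarrow> bool" where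
  "greedy_set e' t x A \<longleftrightarrow> finite A \<and> (\<forall>i\<in>A. \<forall>j. j \<notin> A \<longrightarrow> norm (e' i x) \<ge> t * norm (e' j x))"

text \<open>Greedy sums are not unique: \<open>y\<close> is \<^emph>\<open>a\<close> \<open>t\<close>-greedy sum of \<open>x\<close> of order \<open>m\<close>.\<close>

definition greedy_sum ::
  "('k \<Rightarrow> 'a \<Rightarrow> 'a) \<Rightarrow> (nat \<Rightarrow> 'a) \<Rightarrow> (nat \<Rightarrow> 'a \<Rightarrow> 'k::real_normed_field) \<Rightarrow> real \<Rightarrow> nat \<Rightarrow>
     'a \<Rightarrow> 'a::comm_monoid_add \<Rightarrow> bool" where
  "greedy_sum smul e e' t m x y \<longleftrightarrow>
     (\<exists>A. greedy_set e' t x A \<and> card A = m \<and> y = coord_proj smul e e' A x)"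

end

theory Submission
  imports Defs
begin

text \<open>
  Projections onto boundedly many coordinates are uniformly bounded, and coordinates tend to zero.
  So finitely many coordinates can be discarded, or exchanged to correct the cardinality of a
  greedy set, and small perturbations pass from finite support to all vectors. Uniform boundedness
  also gives convergence: once an approximant with support \<open>D\<close> is subtracted, the greedy sets of
  the remainder differ from those of \<open>x\<close> by \<^term>\<open>card D\<close> negligible coordinates. Conversely,
  if the greedy projections are not uniformly bounded on finitely supported vectors far out, a
  gliding hump assembles a vector \<open>x\<close> from blocks of rapidly decreasing size: all earlier blocks
  together with a greedy subset of the next one form a greedy set for \<open>x\<close>, and these have
  unbounded projections. There, removing as many elements as the earlier blocks contribute
  keeps the cardinality admissible.
\<close>

section \<open>Extremal choices from families of real numbers\<close>

lemma exists_max_outside: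
  fixes f :: "nat \<Rightarrow> real"
  assumes fin: "\<And>\<epsilon>. \<epsilon> > 0 \<Longrightarrow> finite {i. f i \<ge> \<epsilon>}" and "finite F" and nonneg: "\<And>i. f i \<ge> 0"
  shows "\<exists>i. i \<notin> F \<and> (\<forall>j. j \<notin> F \<longrightarrow> f j \<le> f i)"
proof (cases "\<exists>j. j \<notin> F \<and> f j > 0")
  case True
  then obtain j0 where j0: "j0 \<notin> F" "f j0 > 0" by blast
  \<comment> \<open>Only finitely many values reach the positive level \<open>f j0\<close>, so a
    maximum over \<open>S\<close> exists; the remaining values outside \<open>F\<close> lie below
    that level.\<close>
  define S where "S = {i. f i \<ge> f j0} - F"
  have S: "finite S" "S \<noteq> {}" using fin[OF j0(2)] j0(1) by (auto simp: S_def)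
  then have "Max (f ` S) \<in> f ` S" by (intro Max_in) auto
  then obtain i where i: "i \<in> S" "f i = Max (f ` S)" by auto
  then have max: "f j \<le> f i" if "j \<in> S" for j
    using that S(1) by simp
  have "f j \<le> f i" if "j \<notin> F" for j
  proof (cases "j \<in> S")
    case False
    then have "f j < f j0" using that by (simp add: S_def)
    also have "\<dots> \<le> f i" using i(1) by (simp add: S_def)
    finally show ?thesis by simp
  qed (use max in simp)
  then show ?thesis using i(1) by (auto simp: S_def)
next
  case False
  obtain i where i: "i \<notin> F" using \<open>finite F\<close> ex_new_if_finite infinite_UNIV_nat by blast
  then show ?thesis using False nonneg by (meson not_le order_trans)
qed

text \<open>A maximal remaining index is adjoined \<open>r\<close> times. An index left over was
  available at each stage, hence is dominated by all the chosen ones.\<close>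

lemma exists_largest_outside:
  fixes f :: "nat \<Rightarrow> real"
  assumes fin: "\<And>\<epsilon>. \<epsilon> > 0 \<Longrightarrow> finite {i. f i \<ge> \<epsilon>}" and F: "finite F" and nonneg: "\<And>i. f i \<ge> 0"
  shows "\<exists>E. finite E \<and> E \<inter> F = {} \<and> card E = r \<and> (\<forall>i\<in>E. \<forall>j. j \<notin> F \<union> E \<longrightarrow> f j \<le> f i)"
proof (induction r)
  case 0
  show ?case by (intro exI[of _ "{}"]) auto
next
  case (Suc r)
  then obtain E where E: "finite E" "E \<inter> F = {}" "card E = r"
    "\<forall>i\<in>E. \<forall>j. j \<notin> F \<union> E \<longrightarrow> f j \<le> f i" by blast
  obtain i where i: "i \<notin> F \<union> E" "\<forall>j. j \<notin> F \<union> E \<longrightarrow> f j \<le> f i"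
    using exists_max_outside[of f "F \<union> E", OF fin _ nonneg] F E(1) by auto
  show ?case
    using E i by (intro exI[of _ "insert i E"]) auto
qed

lemma exists_smallest_subset:
  fixes f :: "'b \<Rightarrow> real"
  assumes "finite A" "r \<le> card A"
  shows "\<exists>R\<subseteq>A. card R = r \<and> (\<forall>i\<in>A - R. \<forall>j\<in>R. f j \<le> f i)"
  using assms(2)
proof (induction r)
  case 0
  show ?case by (intro exI[of _ "{}"]) auto
next
  case (Suc r)
  then obtain R where R: "R \<subseteq> A" "card R = r" "\<forall>i\<in>A - R. \<forall>j\<in>R. f j \<le> f i" by auto
  have fR: "finite R" using R(1) assms(1) finite_subset by blast
  have S: "finite (A - R)" "A - R \<noteq> {}"
    using assms(1) R(1,2) Suc.prems by (auto dest: card_mono[OF fR])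
  then have "Min (f ` (A - R)) \<in> f ` (A - R)" by (intro Min_in) auto
  then obtain i where i: "i \<in> A - R" "f i = Min (f ` (A - R))" by auto
  then have min: "f i \<le> f j" if "j \<in> A - R" for j
    using that S(1) by simp
  show ?case
    using R i(1) min fR by (intro exI[of _ "insert i R"]) auto
qed

lemma finite_positive_lower_bound:
  fixes f :: "'b \<Rightarrow> real"
  assumes "finite D" "\<And>i. i \<in> D \<Longrightarrow> f i > 0"
  obtains \<beta> where "\<beta> > 0" "\<And>i. i \<in> D \<Longrightarrow> \<beta> \<le> f i"
proof
  \<comment> \<open>The extra \<open>1\<close> supplies a positive value when \<open>D\<close> is
    empty.\<close>
  show "Min (insert 1 (f ` D)) > 0" using assms by simp
  show "Min (insert 1 (f ` D)) \<le> f i" if "i \<in> D" for i using that assms(1) by (intro Min_le) auto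
qed

section \<open>Quasi-norms and coordinate functionals\<close>

lemma topspace_qnorm_topology [simp]: "topspace (qnorm_topology N) = UNIV"
proof -
  have "openin (qnorm_topology N) UNIV"
    unfolding openin_qnorm_topology by (auto intro: exI[of _ 1])
  then show ?thesis using openin_subset by blast
qed

context quasi_banach_space
begin

lemma qnorm_zero [simp]: "qnorm 0 = 0"
  by (simp add: qnorm_eq_0_iff)

lemma qnorm_minus [simp]: "qnorm (- x) = qnorm x"
  using qnorm_scale[of "-1" x] by simp

lemma qnorm_minus_commute: "qnorm (x - y) = qnorm (y - x)"
  using qnorm_minus[of "x - y"] by simp

lemma qnorm_pos: "x \<noteq> 0 \<Longrightarrow> qnorm x > 0"
  using qnorm_nonneg[of x] qnorm_eq_0_iff[of x] by linarith

lemma qnorm_scale_of_real: "qnorm (smul (of_real r) x) = \<bar>r\<bar> * qnorm x"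
  by (simp add: qnorm_scale)

text \<open>
  The supremum defining \<^const>\<open>dual_qnorm\<close> carries information only once the functional is
  known to be bounded on the unit ball; this is where continuity enters.
\<close>

lemma norm_le_dual_qnorm:
  assumes lin: "Vector_Spaces.linear smul (*) f"
    and cont: "continuous_map (qnorm_topology qnorm) euclidean f"
  shows "norm (f x) \<le> dual_qnorm qnorm f * qnorm x"
proof -
  interpret f: Vector_Spaces.linear smul "(*)" f by (rule lin)
  have scale: "norm (f (smul (of_real r) y)) = \<bar>r\<bar> * norm (f y)" for r y
    by (simp add: f.scale norm_mult)
  have "openin (qnorm_topology qnorm) {y \<in> topspace (qnorm_topology qnorm). f y \<in> ball 0 1}"
    using cont by (rule openin_continuous_map_preimage) simp
  moreover have "0 \<in> {y \<in> topspace (qnorm_topology qnorm). f y \<in> ball 0 1}"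
    by (simp add: f.zero)
  ultimately have "\<exists>r>0. {y. qnorm (y - 0) < r} \<subseteq>
      {y \<in> topspace (qnorm_topology qnorm). f y \<in> ball 0 1}"
    unfolding openin_qnorm_topology by (rule bspec)
  then obtain r where r: "r > 0" "{y. qnorm (y - 0) < r} \<subseteq> {y. norm (f y) < 1}"
    by auto
  \<comment> \<open>Scaling by \<open>r / 2\<close> instead of \<open>r\<close> gives the strict
    inequality that the neighbourhood of \<open>0\<close> requires.\<close>
  have unit: "norm (f y) \<le> 2 / r" if "qnorm y \<le> 1" for y
  proof -
    have "qnorm (smul (of_real (r / 2)) y) < r"
      using that r(1) unfolding qnorm_scale_of_real
      by (smt (verit, best) field_sum_of_halves mult_left_le qnorm_nonneg)
    then have "norm (f (smul (of_real (r / 2)) y)) < 1" using r(2) by auto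
    then show ?thesis using r(1) unfolding scale by (simp add: field_simps)
  qed
  have le: "norm (f y) \<le> dual_qnorm qnorm f" if "qnorm y \<le> 1" for y
    unfolding dual_qnorm_def
    by (rule cSUP_upper) (use that unit in \<open>auto intro!: bdd_aboveI[of _ "2 / r"]\<close>)
  show ?thesis
  proof (cases "x = 0")
    case False
    then have pos: "qnorm x > 0" by (rule qnorm_pos)
    have "norm (f (smul (of_real (1 / qnorm x)) x)) \<le> dual_qnorm qnorm f"
      by (rule le, unfold qnorm_scale_of_real) (use pos in simp)
    then show ?thesis using pos unfolding scale by (simp add: field_simps)
  qed (simp add: f.zero)
qed

end

text \<open>Fixes once and for all the constants whose existence a basis only asserts: the modulus
  \<open>\<kappa>\<close> of the quasi-norm and one bound \<open>c\<close> for both basis vectors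
  and functionals, the latter in pointwise form.\<close>

locale greedy_M_basis = semi_normalized_M_basis smul qnorm e e'
  for smul :: "'k::real_normed_field \<Rightarrow> 'a::ab_group_add \<Rightarrow> 'a" and qnorm e e' +
  fixes \<kappa> c t :: real and n :: "nat \<Rightarrow> nat"
  assumes kappa: "\<kappa> \<ge> 1" and triangle: "qnorm (x + y) \<le> \<kappa> * (qnorm x + qnorm y)"
    and c_pos: "c > 0" and basis_le: "qnorm (e i) \<le> c" and coord_le: "norm (e' i x) \<le> c * qnorm x"
    and t_pos: "0 < t" and t_le_1: "t \<le> 1"
    and n_mono: "strict_mono n"
begin

abbreviation P :: "nat set \<Rightarrow> 'a \<Rightarrow> 'a" where "P \<equiv> coord_proj smul e e'"
abbreviation greedy :: "'a \<Rightarrow> nat set \<Rightarrow> bool" where "greedy \<equiv> greedy_set e' t"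

text \<open>Bounds any combination of \<open>s\<close> basis vectors with coefficients of modulus at
  most \<open>1\<close>. The bound is crude, but it depends on \<open>s\<close> alone.\<close>

definition K :: "nat \<Rightarrow> real" where "K s = \<kappa> ^ s * s * c"

text \<open>The first three conditions of the theorem differ only in the set
  \<open>X\<close>.\<close>

definition greedy_bounded_on :: "'a set \<Rightarrow> real \<Rightarrow> bool" where
  "greedy_bounded_on X C \<longleftrightarrow>
     (\<forall>x A. x \<in> X \<and> greedy x A \<and> card A \<in> range n \<longrightarrow> qnorm (P A x) \<le> C * qnorm x)"

lemma coord_add: "e' i (x + y) = e' i x + e' i y"
  and coord_diff: "e' i (x - y) = e' i x - e' i y"
  and coord_zero [simp]: "e' i 0 = 0"
  and coord_scale: "e' i (smul a x) = a * e' i x"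
  and coord_sum: "e' i (sum g S) = (\<Sum>s\<in>S. e' i (g s))"
proof -
  interpret f: Vector_Spaces.linear smul "(*)" "e' i" by (rule coord_linear)
  show "e' i (x + y) = e' i x + e' i y" "e' i (x - y) = e' i x - e' i y" "e' i 0 = 0"
    "e' i (smul a x) = a * e' i x" "e' i (sum g S) = (\<Sum>s\<in>S. e' i (g s))"
    by (rule f.add f.diff f.zero f.scale f.sum)+
qed

lemma coord_sum_basis:
  assumes "finite A"
  shows "e' j (\<Sum>i\<in>A. smul (a i) (e i)) = (if j \<in> A then a j else 0)"
proof -
  have "e' j (\<Sum>i\<in>A. smul (a i) (e i)) = (\<Sum>i\<in>A. if j = i then a i else 0)"
    unfolding coord_sum by (intro sum.cong) (auto simp: coord_scale biorthogonal)
  then show ?thesis using assms by simp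
qed

lemma coord_P: "finite A \<Longrightarrow> e' j (P A x) = (if j \<in> A then e' j x else 0)"
  unfolding coord_proj_def by (rule coord_sum_basis)

text \<open>Totality reduces identities between vectors to coordinates; most decompositions of
  projections below are checked in this way.\<close>

lemma eq_if_coords_eq: "(\<And>i. e' i x = e' i y) \<Longrightarrow> x = y"
  using total[of "x - y"] by (simp add: coord_diff)

lemma P_diff: "finite A \<Longrightarrow> P A (x - y) = P A x - P A y"
  by (rule eq_if_coords_eq) (simp add: coord_diff coord_P)

lemma P_scale: "finite A \<Longrightarrow> P A (smul a x) = smul a (P A x)"
  by (rule eq_if_coords_eq) (simp add: coord_scale coord_P)

lemma P_eq_self: "finite A \<Longrightarrow> supp e' x \<subseteq> A \<Longrightarrow> P A x = x"
  by (rule eq_if_coords_eq) (auto simp: coord_P supp_def)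

lemma triangle_diff: "qnorm (x - y) \<le> \<kappa> * (qnorm x + qnorm y)"
  using triangle[of x "- y"] by simp

lemma kappa_pos: "\<kappa> > 0"
  using kappa by simp

lemma K_nonneg: "K s \<ge> 0"
  using kappa_pos c_pos by (simp add: K_def)

lemma K_mono: "r \<le> s \<Longrightarrow> K r \<le> K s"
  unfolding K_def using kappa c_pos by (intro mult_mono power_increasing) auto

lemma qnorm_sum_le:
  assumes "finite A" "\<And>i. i \<in> A \<Longrightarrow> qnorm (g i) \<le> b"
  shows "qnorm (sum g A) \<le> \<kappa> ^ card A * card A * b"
  using assms
proof (induction A)
  case (insert i A)
  let ?s = "card A"
  have b: "b \<ge> 0" using insert.prems[of i] qnorm_nonneg[of "g i"] by simp
  have "qnorm (sum g (insert i A)) \<le> \<kappa> * (qnorm (g i) + qnorm (sum g A))"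
    using triangle insert.hyps by simp
  also have "\<dots> \<le> \<kappa> * (b + \<kappa> ^ ?s * ?s * b)"
    using insert kappa_pos by (intro mult_left_mono add_mono) auto
  also have "\<dots> \<le> \<kappa> * (\<kappa> ^ ?s * b + \<kappa> ^ ?s * ?s * b)"
    using kappa b mult_right_mono[OF one_le_power[OF kappa, of ?s] b] by (intro mult_left_mono) auto
  also have "\<dots> = \<kappa> ^ card (insert i A) * card (insert i A) * b"
    using insert.hyps by (simp add: algebra_simps)
  finally show ?case .
qed simp

lemma qnorm_P_le:
  assumes "finite A" "card A \<le> s" "\<And>i. i \<in> A \<Longrightarrow> norm (e' i x) \<le> b" "b \<ge> 0"
  shows "qnorm (P A x) \<le> K s * b"
proof -
  have "qnorm (smul (e' i x) (e i)) \<le> b * c" if "i \<in> A" for i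
    unfolding qnorm_scale using assms(3)[OF that] basis_le qnorm_nonneg \<open>b \<ge> 0\<close>
    by (intro mult_mono) auto
  then have "qnorm (P A x) \<le> \<kappa> ^ card A * card A * (b * c)"
    unfolding coord_proj_def by (rule qnorm_sum_le[OF assms(1)])
  also have "\<dots> = K (card A) * b" by (simp add: K_def)
  also have "\<dots> \<le> K s * b" using K_mono[OF assms(2)] \<open>b \<ge> 0\<close> by (rule mult_right_mono)
  finally show ?thesis .
qed

lemma qnorm_P_le_qnorm:
  assumes "finite A" "card A \<le> s"
  shows "qnorm (P A x) \<le> K s * c * qnorm x"
  using qnorm_P_le[OF assms coord_le] c_pos qnorm_nonneg by (simp add: mult.assoc)

text \<open>Density is given by a topological closure, and balls need not be open. So the points
  approximable from the span are shown to form a closed set; it contains the span, hence everything,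
  and vectors of the span have finite support.\<close>

lemma finite_supp_approx:
  assumes "\<epsilon> > 0"
  obtains y where "finite (supp e' y)" "qnorm (x - y) < \<epsilon>"
proof -
  define C where "C = {x. \<forall>\<epsilon>>0. \<exists>y\<in>span (range e). qnorm (x - y) < \<epsilon>}"
  have "openin (qnorm_topology qnorm) (- C)"
    unfolding openin_qnorm_topology
  proof
    fix x assume "x \<in> - C"
    then obtain r where r: "r > 0" "\<And>y. y \<in> span (range e) \<Longrightarrow> \<not> qnorm (x - y) < r"
      unfolding C_def by blast
    have "z \<in> - C" if z: "qnorm (z - x) < r / (2 * \<kappa>)" for z
    proof
      assume "z \<in> C"
      then obtain y where y: "y \<in> span (range e)" "qnorm (z - y) < r / (2 * \<kappa>)"
        unfolding C_def using r(1) kappa_pos by (auto dest: spec[of _ "r / (2 * \<kappa>)"])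
      have "qnorm (x - y) \<le> \<kappa> * (qnorm (x - z) + qnorm (z - y))"
        using triangle[of "x - z" "z - y"] by simp
      also have "\<dots> < \<kappa> * (r / (2 * \<kappa>) + r / (2 * \<kappa>))"
        using z y(2) kappa_pos by (intro mult_strict_left_mono) (auto simp: qnorm_minus_commute)
      also have "\<dots> = r" using kappa_pos by (simp add: field_simps)
      finally show False using r(2)[OF y(1)] by simp
    qed
    then show "\<exists>r>0. {z. qnorm (z - x) < r} \<subseteq> - C"
      using r(1) kappa_pos by (intro exI[of _ "r / (2 * \<kappa>)"]) auto
  qed
  then have "closedin (qnorm_topology qnorm) C"
    by (simp add: closedin_def Compl_eq_Diff_UNIV)
  moreover have "span (range e) \<subseteq> C"
    unfolding C_def by force
  ultimately have "x \<in> C" using closure_of_minimal dense_span by blast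
  then obtain y where y: "y \<in> span (range e)" "qnorm (x - y) < \<epsilon>"
    unfolding C_def using assms by blast
  have "subspace {y. finite (supp e' y)}"
  proof (rule subspaceI)
    fix x y assume "x \<in> {y. finite (supp e' y)}" "y \<in> {y. finite (supp e' y)}"
    moreover have "supp e' (x + y) \<subseteq> supp e' x \<union> supp e' y" by (auto simp: supp_def coord_add)
    ultimately show "x + y \<in> {y. finite (supp e' y)}" by (auto intro: finite_subset)
  next
    fix a x assume "x \<in> {y. finite (supp e' y)}"
    moreover have "supp e' (smul a x) \<subseteq> supp e' x" by (auto simp: supp_def coord_scale)
    ultimately show "smul a x \<in> {y. finite (supp e' y)}" by (auto intro: finite_subset)
  qed (simp add: supp_def)
  moreover have "range e \<subseteq> {y. finite (supp e' y)}"
    by (auto simp: supp_def biorthogonal)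
  ultimately have "finite (supp e' y)" using y(1) span_minimal by blast
  with y(2) that show ?thesis by blast
qed

text \<open>Off the support of a finitely supported approximant \<open>y\<close>, the coordinates of
  \<open>x\<close> are those of \<open>x - y\<close>, hence small.\<close>

lemma finite_large_coords:
  assumes "\<epsilon> > 0"
  shows "finite {i. norm (e' i x) \<ge> \<epsilon>}"
proof -
  obtain y where y: "finite (supp e' y)" "qnorm (x - y) < \<epsilon> / c"
    using finite_supp_approx[of "\<epsilon> / c" x] assms c_pos by auto
  have "norm (e' i x) < \<epsilon>" if "i \<notin> supp e' y" for i
  proof -
    have "norm (e' i x) = norm (e' i (x - y))" using that by (simp add: coord_diff supp_def)
    also have "\<dots> \<le> c * qnorm (x - y)" by (rule coord_le)
    also have "\<dots> < \<epsilon>" using y(2) c_pos by (simp add: field_simps)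
    finally show ?thesis .
  qed
  then have "{i. norm (e' i x) \<ge> \<epsilon>} \<subseteq> supp e' y" by force
  then show ?thesis using y(1) finite_subset by blast
qed

section \<open>Greedy sets: existence and modification\<close>

lemma scale_t_le: "norm a \<le> r \<Longrightarrow> t * norm a \<le> r"
  using t_pos t_le_1 by (meson less_imp_le mult_left_le_one_le norm_ge_zero order_trans)

lemma greedy_extension:
  assumes "finite F"
  obtains E where "finite E" "E \<inter> F = {}" "card E = r"
    "\<And>i j. i \<in> E \<Longrightarrow> j \<notin> F \<union> E \<Longrightarrow> norm (e' j x) \<le> norm (e' i x)"
  using exists_largest_outside[of "\<lambda>i. norm (e' i x)" F r, OF finite_large_coords assms] by auto

lemma greedy_set_exists:
  obtains A where "greedy x A" "card A = r"
proof -
  obtain E where "finite E" "card E = r"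
    "\<And>i j. i \<in> E \<Longrightarrow> j \<notin> {} \<union> E \<Longrightarrow> norm (e' j x) \<le> norm (e' i x)"
    by (rule greedy_extension[of "{}" r x]) auto
  then have "greedy x E" unfolding greedy_set_def by (auto intro: scale_t_le)
  with \<open>card E = r\<close> that show ?thesis by blast
qed

text \<open>
  Brings cardinalities back into the range of \<^term>\<open>n\<close>: \<open>R\<close> consists of the smallest
  coordinates in \<open>A\<close>, and the cost of removing it depends only on \<open>r\<close>.
\<close>

lemma greedy_removal:
  assumes "greedy x A" "r \<le> card A"
  obtains R where "R \<subseteq> A" "card R = r" "greedy x (A - R)"
proof -
  have fin: "finite A" using assms(1) by (simp add: greedy_set_def)
  obtain R where R: "R \<subseteq> A" "card R = r" "\<forall>i\<in>A - R. \<forall>j\<in>R. norm (e' j x) \<le> norm (e' i x)"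
    using exists_smallest_subset[OF fin assms(2), of "\<lambda>i. norm (e' i x)"] by auto
  then have "greedy x (A - R)"
    using assms(1) unfolding greedy_set_def by (auto intro: scale_t_le)
  with R that show ?thesis by blast
qed

text \<open>As \<open>t > 0\<close>, a zero coordinate in \<open>A\<close> forces all coordinates
  outside \<open>A\<close> to vanish. In this degenerate case \<open>P A x = x\<close>.\<close>

lemma greedy_zero_coord:
  assumes "greedy x A" "i \<in> A" "e' i x = 0"
  shows "supp e' x \<subseteq> A"
proof
  fix j assume j: "j \<in> supp e' x"
  show "j \<in> A"
  proof (rule ccontr)
    assume "j \<notin> A"
    then have "t * norm (e' j x) \<le> 0" using assms unfolding greedy_set_def by force
    then show False using j t_pos by (auto simp: supp_def mult_le_0_iff)
  qed
qed

section \<open>Extending uniform boundedness\<close>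

text \<open>The coordinates up to \<open>m\<close> are dropped from \<open>x\<close>, and the
  elements of \<open>A\<close> among them are replaced by equally many of the largest remaining
  coordinates. This affects at most \<open>Suc m\<close> coordinates each time, since indices start
  at \<open>0\<close>.\<close>

lemma greedy_bounded_tail_imp_finite_supp:
  assumes C: "C > 0" and bdd: "greedy_bounded_on {x. finite (supp e' x) \<and> (\<forall>j\<in>supp e' x. m < j)} C"
  shows "\<exists>C>0. greedy_bounded_on {x. finite (supp e' x)} C"
proof -
  define L where "L = K (Suc m) * c"
  have L: "L \<ge> 0" using K_nonneg c_pos by (simp add: L_def)
  have Lq: "qnorm (P A x) \<le> L * qnorm x" if "finite A" "card A \<le> Suc m" for A x
    unfolding L_def by (rule qnorm_P_le_qnorm[OF that])
  define C' where "C' = \<kappa> * (L + \<kappa> * (C * (\<kappa> * (1 + L)) + L * (\<kappa> * (1 + L))))"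
  have "qnorm (P A x) \<le> C' * qnorm x"
    if x: "finite (supp e' x)" and A: "greedy x A" and cA: "card A \<in> range n" for x A
  proof -
    have fA: "finite A" using A by (simp add: greedy_set_def)
    define x' where "x' = x - P {..m} x"
    have coord: "e' j x' = (if j \<le> m then 0 else e' j x)" for j
      by (simp add: x'_def coord_diff coord_P)
    define F where "F = A - {..m}"
    have fF: "finite F" using fA by (simp add: F_def)
    obtain E where E: "finite E" "E \<inter> F = {}" "card E = card (A \<inter> {..m})"
      "\<And>i j. i \<in> E \<Longrightarrow> j \<notin> F \<union> E \<Longrightarrow> norm (e' j x') \<le> norm (e' i x')"
      using greedy_extension[OF fF] by metis
    have cE: "card E \<le> Suc m" using E(3) card_mono[of "{..m}" "A \<inter> {..m}"] by simp
    have "card (F \<union> E) = card F + card E"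
      using fF E(1,2) by (intro card_Un_disjoint) auto
    also have "\<dots> = card A"
      unfolding E(3) F_def using fA card_Int_Diff[of A "{..m}"] by simp
    finally have card: "card (F \<union> E) \<in> range n" using cA by simp
    \<comment> \<open>An index outside \<open>F\<close> is either at most \<open>m\<close>, where
      \<open>x'\<close> vanishes, or outside \<open>A\<close>, where greediness for \<open>x\<close>
      applies.\<close>
    have "norm (e' i x') \<ge> t * norm (e' j x')" if "i \<in> F" "j \<notin> F" for i j
      using A that unfolding greedy_set_def by (auto simp: coord F_def)
    then have greedy: "greedy x' (F \<union> E)"
      using E(4) fF E(1) unfolding greedy_set_def by (auto intro: scale_t_le)
    have "supp e' x' \<subseteq> supp e' x" "\<forall>j\<in>supp e' x'. m < j"
      by (auto simp: supp_def coord split: if_splits intro!: leI)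
    then have "qnorm (P (F \<union> E) x') \<le> C * qnorm x'"
      using bdd greedy card finite_subset[OF _ x] unfolding greedy_bounded_on_def by blast
    moreover have "qnorm (P E x') \<le> L * qnorm x'" by (rule Lq[OF E(1) cE])
    moreover have "P F x' = P (F \<union> E) x' - P E x'"
      by (rule eq_if_coords_eq) (use fF E(1,2) in \<open>auto simp: coord_diff coord_P\<close>)
    ultimately have "qnorm (P F x') \<le> \<kappa> * (C * qnorm x' + L * qnorm x')"
      using kappa_pos by (simp only:) (rule order_trans[OF triangle_diff], simp)
    also have "\<dots> = \<kappa> * (C + L) * qnorm x'" by (simp add: algebra_simps)
    also have "qnorm x' \<le> \<kappa> * (1 + L) * qnorm x"
    proof -
      have "qnorm x' \<le> \<kappa> * (qnorm x + qnorm (P {..m} x))"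
        unfolding x'_def by (rule triangle_diff)
      also have "\<dots> \<le> \<kappa> * (qnorm x + L * qnorm x)"
        using kappa_pos Lq[of "{..m}" x] by simp
      finally show ?thesis by (simp add: algebra_simps)
    qed
    finally have PF: "qnorm (P F x') \<le> \<kappa> * (C + L) * (\<kappa> * (1 + L) * qnorm x)"
      using kappa_pos C L by (simp add: mult_left_mono)
    have "P A x = P (A \<inter> {..m}) x + P F x'"
      by (rule eq_if_coords_eq) (use fA fF in \<open>auto simp: coord_add coord_P coord F_def\<close>)
    then have "qnorm (P A x) \<le> \<kappa> * (qnorm (P (A \<inter> {..m}) x) + qnorm (P F x'))"
      using triangle by simp
    also have "\<dots> \<le> \<kappa> * (L * qnorm x + \<kappa> * (C + L) * (\<kappa> * (1 + L) * qnorm x))"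
      using kappa_pos PF Lq[of "A \<inter> {..m}" x] fA cE E(3) by (intro mult_left_mono add_mono) auto
    also have "\<dots> = C' * qnorm x" by (simp add: C'_def algebra_simps)
    finally show ?thesis .
  qed
  moreover have "C' > 0"
    unfolding C'_def using C L kappa_pos by (intro mult_pos_pos add_nonneg_pos add_pos_nonneg mult_nonneg_nonneg) auto
  ultimately show ?thesis unfolding greedy_bounded_on_def by blast
qed

text \<open>
  To pass to arbitrary vectors, \<^term>\<open>x\<close> is first replaced by \<open>x + \<delta> P\<^sub>A x\<close>: the greedy
  inequalities become strict and survive a small perturbation.
\<close>

lemma greedy_bounded_finite_supp_imp_all:
  assumes C: "C > 0" and bdd: "greedy_bounded_on {x. finite (supp e' x)} C"
  shows "\<exists>C>0. greedy_bounded_on UNIV C"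
proof -
  define C' where "C' = \<kappa> * (C * (2 * \<kappa>) + 1)"
  have CC': "C \<le> C'"
  proof -
    have "1 * C \<le> (2 * \<kappa> * \<kappa>) * C"
      using kappa C mult_mono[OF kappa kappa] by (intro mult_right_mono) auto
    then show ?thesis unfolding C'_def using kappa_pos by (simp add: algebra_simps)
  qed
  have "qnorm (P A x) \<le> C' * qnorm x" if A: "greedy x A" and cA: "card A \<in> range n" for x A
  proof (cases "finite (supp e' x)")
    case True
    then have "qnorm (P A x) \<le> C * qnorm x"
      using bdd A cA unfolding greedy_bounded_on_def by blast
    also have "\<dots> \<le> C' * qnorm x" using CC' qnorm_nonneg by (rule mult_right_mono)
    finally show ?thesis .
  next
    case False
    have fA: "finite A" using A by (simp add: greedy_set_def)
    have "x \<noteq> 0" using False by (auto simp: supp_def)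
    then have x: "qnorm x > 0" by (rule qnorm_pos)
    \<comment> \<open>A zero coordinate would put the infinite support inside the finite set
      \<open>A\<close>.\<close>
    have "e' i x \<noteq> 0" if "i \<in> A" for i
      using greedy_zero_coord[OF A that] False fA finite_subset by blast
    then obtain \<beta> where \<beta>: "\<beta> > 0" "\<And>i. i \<in> A \<Longrightarrow> \<beta> \<le> norm (e' i x)"
      using finite_positive_lower_bound[OF fA, of "\<lambda>i. norm (e' i x)"] by auto
    define L where "L = K (card A) * c"
    have L: "L \<ge> 0" using K_nonneg c_pos by (simp add: L_def)
    \<comment> \<open>Chosen so that \<open>qnorm (x - y)\<close> and
      \<open>L * qnorm (x - y)\<close> are both at most \<open>qnorm x\<close>. Although
      \<open>L\<close> depends on \<open>card A\<close>, the final constant then does not.\<close>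
    define \<eta> where "\<eta> = qnorm x / ((1 + L) * (2 * \<kappa>))"
    have \<eta>: "\<eta> > 0" using x L kappa_pos by (simp add: \<eta>_def)
    define \<delta> where "\<delta> = \<eta> / (1 + qnorm (P A x))"
    have \<delta>: "\<delta> > 0" using \<eta> qnorm_nonneg[of "P A x"] by (simp add: \<delta>_def)
    define w where "w = x + smul (of_real \<delta>) (P A x)"
    \<comment> \<open>Enlarging the coordinates on \<open>A\<close> by the factor
      \<open>1 + \<delta>\<close> opens a gap of at least \<open>\<delta> * \<beta>\<close>; the
      second bound limits each coordinate error to half of it.\<close>
    have "min \<eta> (\<delta> * \<beta> / (2 * c)) > 0" using \<eta> \<delta> \<beta>(1) c_pos by simp
    then obtain y where y: "finite (supp e' y)" "qnorm (w - y) < min \<eta> (\<delta> * \<beta> / (2 * c))"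
      using finite_supp_approx[of _ w] by blast
    have close: "norm (e' i w - e' i y) \<le> \<delta> * \<beta> / 2" for i
    proof -
      have "norm (e' i w - e' i y) \<le> c * qnorm (w - y)"
        using coord_le[of i "w - y"] by (simp add: coord_diff)
      also have "\<dots> \<le> c * (\<delta> * \<beta> / (2 * c))"
        using y(2) c_pos by (intro mult_left_mono) auto
      finally show ?thesis using c_pos by simp
    qed
    have "norm (e' i y) \<ge> t * norm (e' j y)" if i: "i \<in> A" and j: "j \<notin> A" for i j
    proof -
      have wj: "e' j w = e' j x" using fA j by (simp add: w_def coord_add coord_scale coord_P)
      have "e' i w = (1 + of_real \<delta>) * e' i x"
        using fA i by (simp add: w_def coord_add coord_scale coord_P algebra_simps)
      then have wi: "norm (e' i w) = (1 + \<delta>) * norm (e' i x)"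
        using \<delta> norm_of_real[of "1 + \<delta>", where 'a = 'k] by (simp add: norm_mult)
      have "norm (e' j y) \<le> norm (e' j x) + \<delta> * \<beta> / 2"
        using close[of j] norm_triangle_ineq2[of "e' j y" "e' j w"]
        by (simp add: wj norm_minus_commute)
      then have "t * norm (e' j y) \<le> t * norm (e' j x) + t * (\<delta> * \<beta> / 2)"
        using t_pos by (metis distrib_left less_imp_le mult_left_mono)
      also have "\<dots> \<le> norm (e' i x) + \<delta> * \<beta> / 2"
        using A i j t_pos t_le_1 \<delta> \<beta>(1) unfolding greedy_set_def
        by (intro add_mono mult_left_le_one_le) auto
      also have "\<dots> \<le> (1 + \<delta>) * norm (e' i x) - \<delta> * \<beta> / 2"
        using mult_left_mono[OF \<beta>(2)[OF i], of \<delta>] \<delta> by (simp add: algebra_simps)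
      also have "\<dots> \<le> norm (e' i y)"
        using close[of i] norm_triangle_ineq2[of "e' i w" "e' i y"] by (simp add: wi)
      finally show ?thesis .
    qed
    then have "greedy y A" using fA unfolding greedy_set_def by blast
    then have Py: "qnorm (P A y) \<le> C * qnorm y"
      using bdd y(1) cA unfolding greedy_bounded_on_def by blast
    have "qnorm (w - x) = \<delta> * qnorm (P A x)" using \<delta> by (simp add: w_def qnorm_scale)
    also have "\<dots> = \<eta> * (qnorm (P A x) / (1 + qnorm (P A x)))" by (simp add: \<delta>_def)
    also have "\<dots> \<le> \<eta>"
      using \<eta> qnorm_nonneg[of "P A x"] by (intro mult_right_le_one_le) auto
    finally have wx: "qnorm (w - x) \<le> \<eta>" .
    have "qnorm (x - y) \<le> \<kappa> * (qnorm (x - w) + qnorm (w - y))"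
      using triangle[of "x - w" "w - y"] by simp
    also have "\<dots> \<le> \<kappa> * (\<eta> + \<eta>)"
      using wx y(2) kappa_pos by (intro mult_left_mono add_mono) (auto simp: qnorm_minus_commute)
    also have "\<dots> = \<eta> * (2 * \<kappa>)" by simp
    also have "\<dots> = qnorm x / (1 + L)" using kappa_pos by (simp add: \<eta>_def)
    finally have xy: "qnorm (x - y) \<le> qnorm x / (1 + L)" .
    have "qnorm (x - y) + L * qnorm (x - y) \<le> qnorm x" using xy L by (simp add: field_simps)
    then have xy1: "qnorm (x - y) \<le> qnorm x" and xyL: "L * qnorm (x - y) \<le> qnorm x"
      using qnorm_nonneg[of "x - y"] mult_nonneg_nonneg[OF L qnorm_nonneg[of "x - y"]]
      by linarith+
    have "qnorm y \<le> \<kappa> * (qnorm x + qnorm (x - y))" using triangle_diff[of x "x - y"] by simp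
    also have "\<dots> \<le> \<kappa> * (qnorm x + qnorm x)"
      using xy1 kappa_pos by (intro mult_left_mono) auto
    finally have y2: "qnorm y \<le> 2 * \<kappa> * qnorm x" by simp
    have "P A x = P A y + P A (x - y)" using fA by (simp add: P_diff)
    then have "qnorm (P A x) \<le> \<kappa> * (qnorm (P A y) + qnorm (P A (x - y)))"
      using triangle by metis
    also have "\<dots> \<le> \<kappa> * (C * (2 * \<kappa> * qnorm x) + qnorm x)"
    proof (intro mult_left_mono add_mono)
      show "qnorm (P A y) \<le> C * (2 * \<kappa> * qnorm x)"
        using Py y2 C by (meson less_imp_le mult_left_mono order_trans)
      show "qnorm (P A (x - y)) \<le> qnorm x"
        using qnorm_P_le_qnorm[OF fA order_refl, of "x - y"] xyL by (simp add: L_def)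
    qed (use kappa_pos in simp)
    also have "\<dots> = C' * qnorm x" by (simp add: C'_def algebra_simps)
    finally show ?thesis .
  qed
  then show ?thesis using C CC' unfolding greedy_bounded_on_def
    by (intro exI[of _ C']) auto
qed

section \<open>Convergence of greedy sums\<close>

text \<open>For a finitely supported approximant \<open>y\<close>, the vector \<open>x - y\<close>
  is small and agrees with \<open>x\<close> off \<open>supp e' y\<close>. A small multiple of
  \<open>v\<close> repairs its zero coordinates on that support, so that a positive lower bound
  holds there.\<close>

lemma approx_by_finite_modification:
  assumes "\<eta> > 0"
  obtains z D where "qnorm z < \<eta>" "finite D" "\<And>i. i \<in> D \<Longrightarrow> e' i z \<noteq> 0"
    "\<And>i. i \<notin> D \<Longrightarrow> e' i z = e' i x"
proof -
  obtain y where y: "finite (supp e' y)" "qnorm (x - y) < \<eta> / (2 * \<kappa>)"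
    using finite_supp_approx[of "\<eta> / (2 * \<kappa>)" x] assms kappa_pos by auto
  define Z where "Z = {i \<in> supp e' y. e' i (x - y) = 0}"
  have fZ: "finite Z" using y(1) by (simp add: Z_def)
  define v where "v = (\<Sum>i\<in>Z. smul 1 (e i))"
  define \<delta> where "\<delta> = \<eta> / (2 * \<kappa>) / (1 + qnorm v)"
  have \<delta>: "\<delta> > 0" using assms kappa_pos qnorm_nonneg[of v] by (simp add: \<delta>_def)
  define z where "z = (x - y) + smul (of_real \<delta>) v"
  have coord: "e' i z = e' i (x - y) + (if i \<in> Z then of_real \<delta> else 0)" for i
    unfolding z_def v_def by (simp only: coord_add coord_scale coord_sum_basis[OF fZ]) simp
  have "\<delta> * qnorm v = \<eta> / (2 * \<kappa>) * (qnorm v / (1 + qnorm v))" by (simp add: \<delta>_def)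
  also have "\<dots> \<le> \<eta> / (2 * \<kappa>)"
    using assms kappa_pos qnorm_nonneg[of v] by (intro mult_right_le_one_le) auto
  finally have v: "\<delta> * qnorm v \<le> \<eta> / (2 * \<kappa>)" .
  have "qnorm z \<le> \<kappa> * (qnorm (x - y) + \<delta> * qnorm v)"
    using triangle[of "x - y" "smul (of_real \<delta>) v"] \<delta> by (simp add: z_def qnorm_scale)
  also have "\<dots> < \<kappa> * (\<eta> / (2 * \<kappa>) + \<eta> / (2 * \<kappa>))"
    using y(2) v kappa_pos by (intro mult_strict_left_mono) auto
  also have "\<dots> = \<eta>" using kappa_pos by (simp add: field_simps)
  finally have "qnorm z < \<eta>" .
  moreover have "e' i z \<noteq> 0" if "i \<in> supp e' y" for i
    using that \<delta> by (auto simp: coord Z_def)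
  moreover have "e' i z = e' i x" if "i \<notin> supp e' y" for i
    using that by (simp add: coord Z_def coord_diff) (simp add: supp_def)
  ultimately show ?thesis using that y(1) by blast
qed

text \<open>
  Outside a finite set \<open>D\<close> the vector \<open>x\<close> is replaced by a small \<open>z\<close> with the same coordinates.
  For a large greedy set \<open>A\<close> of \<open>x\<close>, the set \<open>A \<union> D\<close> is greedy for \<open>z\<close>, and so is the set \<open>B\<close>
  of cardinality \<^term>\<open>card A\<close> obtained by discarding its smallest elements outside \<open>D\<close>.
\<close>

lemma greedy_bounded_imp_convergent:
  assumes C: "C > 0" and bdd: "greedy_bounded_on UNIV C"
    and G: "\<And>k. greedy_sum smul e e' t (n k) x (G k)"
  shows "(\<lambda>k. qnorm (G k - x)) \<longlonglongrightarrow> 0"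
proof (rule LIMSEQ_I)
  fix \<epsilon> :: real assume \<epsilon>: "\<epsilon> > 0"
  define \<eta> where "\<eta> = \<epsilon> / (\<kappa> * \<kappa> * (C + 4))"
  have \<eta>: "\<eta> > 0" using \<epsilon> C kappa_pos by (simp add: \<eta>_def)
  obtain z D where z: "qnorm z < \<eta>" "finite D" "\<And>i. i \<in> D \<Longrightarrow> e' i z \<noteq> 0"
    "\<And>i. i \<notin> D \<Longrightarrow> e' i z = e' i x"
    using approx_by_finite_modification[OF \<eta>] by metis
  obtain \<beta> where \<beta>: "\<beta> > 0" "\<And>i. i \<in> D \<Longrightarrow> \<beta> \<le> norm (e' i z)"
    using finite_positive_lower_bound[OF z(2), of "\<lambda>i. norm (e' i z)"] z(3) by auto
  \<comment> \<open>Coordinates of size at most \<open>\<theta>\<close> are dominated by those of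
    \<open>z\<close> on \<open>D\<close>, and projecting onto at most \<open>card D\<close> of them
    costs at most \<open>\<eta>\<close>.\<close>
  define \<theta> where "\<theta> = min \<beta> (\<eta> / (1 + K (card D)))"
  have K0: "1 + K (card D) > 0" using K_nonneg[of "card D"] by simp
  have \<theta>: "\<theta> > 0" "\<theta> \<le> \<beta>" using \<eta> \<beta>(1) K0 by (simp_all add: \<theta>_def)
  have "K (card D) * \<theta> \<le> (1 + K (card D)) * (\<eta> / (1 + K (card D)))"
    using \<theta>(1) K_nonneg by (intro mult_mono) (auto simp: \<theta>_def)
  then have K\<theta>: "K (card D) * \<theta> \<le> \<eta>" using K0 by simp
  define F where "F = {i. norm (e' i x) \<ge> t * \<theta>}"
  have fF: "finite F" unfolding F_def using finite_large_coords t_pos \<theta>(1) by simp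
  \<comment> \<open>As \<open>n k \<ge> k\<close>, both \<open>A\<close> and
    \<open>A - D - R\<close>, which has \<open>card A - card D\<close> elements, are too large to
    lie in \<open>F\<close>. This makes the coordinates outside \<open>A\<close> and those in
    \<open>R\<close> at most \<open>\<theta>\<close>.\<close>
  have "norm (qnorm (G k - x) - 0) < \<epsilon>" if k: "k \<ge> card F + 2 * card D + 1" for k
  proof -
    obtain A where A: "greedy x A" "card A = n k" and Gk: "G k = P A x"
      using G[of k] unfolding greedy_sum_def by blast
    have fA: "finite A" using A(1) by (simp add: greedy_set_def)
    have cA: "card A \<ge> card F + 2 * card D + 1"
      using k strict_mono_imp_increasing[OF n_mono, of k] A(2) by simp
    have out: "norm (e' j x) \<le> \<theta>" if "j \<notin> A" for j
    proof -
      have "\<not> A \<subseteq> F" using card_mono[OF fF, of A] cA by auto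
      then obtain i where "i \<in> A" "i \<notin> F" by blast
      then have i: "i \<in> A" "norm (e' i x) < t * \<theta>" by (auto simp: F_def)
      then have "t * norm (e' j x) < t * \<theta>" using A(1) that unfolding greedy_set_def by force
      then show ?thesis using t_pos by simp
    qed
    have cAD: "card (A - D) = card A - card (A \<inter> D)" and cDA: "card (D - A) = card D - card (A \<inter> D)"
      using fA z(2) by (simp_all add: card_Diff_subset_Int Int_commute)
    have cI: "card (A \<inter> D) \<le> card D" "card (A \<inter> D) \<le> card A"
      using fA z(2) by (auto intro: card_mono)
    obtain R where R: "R \<subseteq> A - D" "card R = card (D - A)"
      "\<forall>i\<in>A - D - R. \<forall>j\<in>R. norm (e' j x) \<le> norm (e' i x)"
    proof -
      have "finite (A - D)" "card (D - A) \<le> card (A - D)" using fA cAD cDA cI cA by auto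
      from exists_smallest_subset[OF this, of "\<lambda>i. norm (e' i x)"] show ?thesis using that by blast
    qed
    have fR: "finite R" using R(1) fA finite_subset by blast
    \<comment> \<open>The indices gained, \<open>D - A\<close>, are balanced by those lost,
      \<open>R\<close>.\<close>
    define B where "B = D \<union> (A - D - R)"
    have fB: "finite B" using fA z(2) by (simp add: B_def)
    have cADR: "card (A - D - R) = card (A - D) - card R"
      using R(1) fR by (simp add: card_Diff_subset)
    have "card B = card D + card (A - D - R)"
      unfolding B_def using fA z(2) by (intro card_Un_disjoint) auto
    also have "\<dots> = card A" using cADR cAD cDA R(2) cI cA by linarith
    finally have cB: "card B \<in> range n" using A(2) by simp
    have Rle: "norm (e' j x) \<le> \<theta>" if j: "j \<in> R" for j
    proof -
      have "card (A - D - R) > card F" using cADR cAD cDA R(2) cI cA by linarith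
      then have "\<not> A - D - R \<subseteq> F" using card_mono[OF fF] by (meson not_le)
      then obtain i where "i \<in> A - D - R" "i \<notin> F" by blast
      then have "i \<in> A - D - R" "norm (e' i x) < t * \<theta>" by (auto simp: F_def)
      moreover have "t * \<theta> \<le> \<theta>" using \<theta>(1) t_pos t_le_1 by (intro mult_left_le_one_le) auto
      ultimately show ?thesis using R(3) j by force
    qed
    have "t * norm (e' j z) \<le> norm (e' i z)" if i: "i \<in> B" and j: "j \<notin> B" for i j
    proof -
      have zj: "e' j z = e' j x" and j': "j \<in> R \<or> j \<notin> A" using j z(4) by (auto simp: B_def)
      show ?thesis
      proof (cases "i \<in> D")
        case True
        have "norm (e' j z) \<le> \<theta>" using zj j' Rle out by auto
        also have "\<dots> \<le> norm (e' i z)" using \<theta>(2) \<beta>(2)[OF True] by simp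
        finally show ?thesis by (rule scale_t_le)
      next
        case False
        then have "i \<in> A - D - R" using i by (simp add: B_def)
        then show ?thesis
          using zj z(4)[OF False] j' R(3) A(1) unfolding greedy_set_def by (auto intro: scale_t_le)
      qed
    qed
    then have "greedy z B" using fB unfolding greedy_set_def by blast
    then have PB: "qnorm (P B z) \<le> C * qnorm z"
      using bdd cB unfolding greedy_bounded_on_def by blast
    \<comment> \<open>Off \<open>D\<close> the vectors \<open>z\<close> and \<open>x\<close> agree,
      and on \<open>D\<close> the first bracket vanishes; the second accounts for the exchanged
      indices.\<close>
    have "P A x - x = (P B z - z) + (P R x - P (D - A) x)"
    proof (rule eq_if_coords_eq)
      fix i
      show "e' i (P A x - x) = e' i (P B z - z + (P R x - P (D - A) x))"
        using fA fB fR z(2,4) R(1) by (auto simp: coord_add coord_diff coord_P B_def)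
    qed
    then have "qnorm (G k - x) \<le> \<kappa> * (qnorm (P B z - z) + qnorm (P R x - P (D - A) x))"
      using triangle Gk by simp
    also have "\<dots> \<le> \<kappa> * (\<kappa> * (C * \<eta> + \<eta>) + \<kappa> * (\<eta> + \<eta>))"
    proof (intro mult_left_mono add_mono)
      have "C * qnorm z \<le> C * \<eta>" using z(1) C by (intro mult_left_mono) auto
      then have "\<kappa> * (qnorm (P B z) + qnorm z) \<le> \<kappa> * (C * \<eta> + \<eta>)"
        using PB z(1) kappa_pos by (intro mult_left_mono add_mono) auto
      then show "qnorm (P B z - z) \<le> \<kappa> * (C * \<eta> + \<eta>)" using triangle_diff order_trans by blast
      have "qnorm (P R x) \<le> K (card D) * \<theta>"
        using fR R(2) cDA Rle \<theta>(1) by (intro qnorm_P_le) auto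
      moreover have "qnorm (P (D - A) x) \<le> K (card D) * \<theta>"
        using z(2) cDA out \<theta>(1) by (intro qnorm_P_le) auto
      ultimately have "\<kappa> * (qnorm (P R x) + qnorm (P (D - A) x)) \<le> \<kappa> * (\<eta> + \<eta>)"
        using K\<theta> kappa_pos by (intro mult_left_mono) auto
      then show "qnorm (P R x - P (D - A) x) \<le> \<kappa> * (\<eta> + \<eta>)" using triangle_diff order_trans by blast
    qed (use kappa_pos in simp)
    also have "\<dots> = \<kappa> * \<kappa> * (C + 3) * \<eta>" by (simp add: algebra_simps)
    also have "\<dots> < \<kappa> * \<kappa> * (C + 4) * \<eta>"
      using \<eta> kappa_pos by simp
    also have "\<dots> = \<epsilon>" using kappa_pos C by (simp add: \<eta>_def)
    finally show ?thesis using qnorm_nonneg by simp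
  qed
  then show "\<exists>M. \<forall>k\<ge>M. norm (qnorm (G k - x) - 0) < \<epsilon>" by blast
qed

text \<open>Convergence concerns one choice of greedy sums at a time. A sequence that exceeds
  \<open>M\<close> whenever some greedy sum of that order does controls all sums of large order;
  small orders involve boundedly many coordinates.\<close>

lemma convergent_imp_greedy_sums_bounded:
  assumes conv: "\<And>G. (\<And>k. greedy_sum smul e e' t (n k) x (G k)) \<Longrightarrow> (\<lambda>k. qnorm (G k - x)) \<longlonglongrightarrow> 0"
  shows "\<exists>C>0. \<forall>A. greedy x A \<and> card A \<in> range n \<longrightarrow> qnorm (P A x) \<le> C"
proof -
  \<comment> \<open>Bounds the quasi-norm of every vector within distance \<open>1\<close> of
    \<open>x\<close>.\<close>
  define M where "M = \<kappa> * (qnorm x + 1)"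
  have "\<exists>y. greedy_sum smul e e' t (n k) x y \<and>
      ((\<exists>y'. greedy_sum smul e e' t (n k) x y' \<and> qnorm y' > M) \<longrightarrow> qnorm y > M)" for k
    using greedy_set_exists[of x "n k"] unfolding greedy_sum_def by blast
  then obtain G where G: "\<And>k. greedy_sum smul e e' t (n k) x (G k)"
    and GM: "\<And>k y'. greedy_sum smul e e' t (n k) x y' \<Longrightarrow> qnorm y' > M \<Longrightarrow> qnorm (G k) > M"
    by metis
  have "\<forall>\<^sub>F k in sequentially. qnorm (G k - x) < 1"
    using conv[OF G] by (rule order_tendstoD) simp
  then obtain k0 where k0: "\<And>k. k \<ge> k0 \<Longrightarrow> qnorm (G k - x) < 1"
    by (auto simp: eventually_sequentially)
  have GleM: "qnorm (G k) \<le> M" if "k \<ge> k0" for k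
  proof -
    have "qnorm (G k) \<le> \<kappa> * (qnorm x + qnorm (G k - x))" using triangle[of x "G k - x"] by simp
    also have "\<dots> \<le> M" unfolding M_def using k0[OF that] kappa_pos by (intro mult_left_mono) auto
    finally show ?thesis .
  qed
  define C where "C = M + K (n k0) * c * qnorm x"
  have M: "M > 0" unfolding M_def using kappa_pos qnorm_nonneg[of x] by (intro mult_pos_pos) auto
  have Kc: "K (n k0) * c * qnorm x \<ge> 0" using K_nonneg c_pos qnorm_nonneg by simp
  have "qnorm (P A x) \<le> C" if A: "greedy x A" "card A = n k" for A k
  proof (cases "k \<ge> k0")
    case True
    have "greedy_sum smul e e' t (n k) x (P A x)" using A unfolding greedy_sum_def by blast
    then have "qnorm (P A x) \<le> M" using GM[of k "P A x"] GleM[OF True] by force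
    then show ?thesis using Kc by (simp add: C_def)
  next
    case False
    then have "n k \<le> n k0" using n_mono by (simp add: strict_mono_less_eq)
    then have "qnorm (P A x) \<le> K (n k0) * c * qnorm x"
      using A by (intro qnorm_P_le_qnorm) (auto simp: greedy_set_def)
    then show ?thesis using M by (simp add: C_def)
  qed
  moreover have "C > 0" using M Kc by (simp add: C_def)
  ultimately show ?thesis by blast
qed

section \<open>The gliding hump\<close>

text \<open>The second clause keeps the support of \<open>S\<close> in front in the greedy order of
  \<open>S'\<close>. The relation is transitive and survives limits, so each stage can be compared
  with the final vector.\<close>

definition extends :: "'a \<Rightarrow> 'a \<Rightarrow> bool" where
  "extends S S' \<longleftrightarrow> (\<forall>i\<in>supp e' S. e' i S' = e' i S \<and>
     (\<forall>j. j \<notin> supp e' S \<longrightarrow> norm (e' j S') \<le> norm (e' i S)))"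

lemma extends_refl: "extends S S"
  by (auto simp: extends_def supp_def)

lemma extends_trans:
  assumes S: "extends S S'" and S': "extends S' S''"
  shows "extends S S''"
  unfolding extends_def
proof (intro ballI conjI allI impI)
  fix i assume i: "i \<in> supp e' S"
  then have eq: "e' i S' = e' i S" using S by (simp add: extends_def)
  then have i': "i \<in> supp e' S'" using i by (simp add: supp_def)
  then show "e' i S'' = e' i S" using S' eq by (simp add: extends_def)
  fix j assume j: "j \<notin> supp e' S"
  show "norm (e' j S'') \<le> norm (e' i S)"
  proof (cases "j \<in> supp e' S'")
    case True
    then show ?thesis using S S' i j by (simp add: extends_def)
  next
    case False
    then show ?thesis using S' i' eq by (metis extends_def)
  qed
qed

text \<open>Coordinates converge by \<open>coord_le\<close>, and equalities and non-strict
  inequalities pass to the limit.\<close>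

lemma extends_limit:
  assumes ext: "\<And>k. k \<ge> j \<Longrightarrow> extends S (X k)" and lim: "(\<lambda>k. qnorm (X k - x)) \<longlonglongrightarrow> 0"
  shows "extends S x"
proof -
  have coord_lim: "(\<lambda>k. e' i (X k)) \<longlonglongrightarrow> e' i x" for i
  proof (rule Lim_null_comparison[THEN LIM_zero_cancel])
    show "\<forall>\<^sub>F k in sequentially. norm (e' i (X k) - e' i x) \<le> c * qnorm (X k - x)"
      using coord_le[of i] by (simp flip: coord_diff)
    show "(\<lambda>k. c * qnorm (X k - x)) \<longlonglongrightarrow> 0" using tendsto_mult_right_zero[OF lim] .
  qed
  show ?thesis
    unfolding extends_def
  proof (intro ballI conjI allI impI)
    fix i assume i: "i \<in> supp e' S"
    have "\<forall>\<^sub>F k in sequentially. e' i (X k) = e' i S"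
      using ext i by (auto simp: extends_def eventually_sequentially)
    then have "(\<lambda>k. e' i (X k)) \<longlonglongrightarrow> e' i S" by (rule tendsto_eventually)
    then show "e' i x = e' i S" using coord_lim LIMSEQ_unique by blast
    fix l assume l: "l \<notin> supp e' S"
    have "\<forall>k\<ge>j. norm (e' l (X k)) \<le> norm (e' i S)"
      using ext i l by (auto simp: extends_def)
    then show "norm (e' l x) \<le> norm (e' i S)"
      using LIMSEQ_le_const2[OF tendsto_norm[OF coord_lim]] by blast
  qed
qed

text \<open>Unboundedness supplies \<open>x\<close> beyond the support of \<open>S\<close> and a
  greedy set \<open>A\<close> with a huge projection. Scaled below the coordinates of
  \<open>S\<close>, it can be added to \<open>S\<close>; discarding \<open>card (supp e' S)\<close>
  smallest elements of \<open>A\<close> makes room for \<open>supp e' S\<close>.\<close>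

lemma hump_step:
  assumes unbdd: "\<And>m C. C > 0 \<Longrightarrow>
      \<not> greedy_bounded_on {x. finite (supp e' x) \<and> (\<forall>j\<in>supp e' x. m < j)} C"
    and S: "finite (supp e' S)" and \<epsilon>: "\<epsilon> > 0" and M: "M \<ge> 0"
  shows "\<exists>S'. finite (supp e' S') \<and> extends S S' \<and> qnorm (S' - S) \<le> \<epsilon> \<and>
    (\<exists>B\<subseteq>supp e' S'. greedy S' B \<and> card B \<in> range n \<and> qnorm (P B S') \<ge> M)"
proof -
  define s where "s = card (supp e' S)"
  obtain m where m: "\<And>i. i \<in> supp e' S \<Longrightarrow> i \<le> m"
    using Max_ge[OF S] by blast
  have "norm (e' i S) > 0" if "i \<in> supp e' S" for i using that by (simp add: supp_def)
  then obtain \<beta> where \<beta>: "\<beta> > 0" "\<And>i. i \<in> supp e' S \<Longrightarrow> \<beta> \<le> norm (e' i S)"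
    using finite_positive_lower_bound[OF S, of "\<lambda>i. norm (e' i S)"] by blast
  \<comment> \<open>A vector of quasi-norm \<open>\<eta>\<close> has coordinates at most
    \<open>\<beta>\<close>, hence dominated by the nonzero ones of \<open>S\<close>.\<close>
  define \<eta> where "\<eta> = min \<epsilon> (\<beta> / c)"
  have \<eta>: "\<eta> > 0" "\<eta> \<le> \<epsilon>" "c * \<eta> \<le> \<beta>"
    using \<epsilon> \<beta>(1) c_pos by (auto simp: \<eta>_def min_def field_simps)
  \<comment> \<open>Once \<open>x\<close> is scaled to quasi-norm \<open>\<eta>\<close>, this factor
    guarantees \<open>\<kappa> * (M + qnorm S)\<close>, so that \<open>M\<close> remains after
    \<open>S\<close> is added.\<close>
  define C1 where "C1 = \<kappa> * (M + qnorm S) / \<eta>"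
  have C1: "C1 \<ge> 0" using \<eta>(1) M kappa_pos qnorm_nonneg by (simp add: C1_def)
  define L where "L = K s * c"
  have L: "L \<ge> 0" using K_nonneg c_pos by (simp add: L_def)
  \<comment> \<open>The three summands exclude \<open>P A x = x\<close>, force
    \<open>card A \<ge> s\<close>, and leave the factor \<open>C1\<close> after the removal of
    \<open>R\<close>.\<close>
  define C where "C = 1 + L + \<kappa> * (C1 + L)"
  have C: "C \<ge> 1" "C \<ge> L" "C \<ge> \<kappa> * (C1 + L)"
    using L C1 kappa_pos by (simp_all add: C_def)
  obtain x A where x: "finite (supp e' x)" "\<And>j. j \<in> supp e' x \<Longrightarrow> m < j"
    and A: "greedy x A" "card A \<in> range n" and big: "qnorm (P A x) > C * qnorm x"
    using unbdd[of C m] C(1) unfolding greedy_bounded_on_def by (auto simp: not_le)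
  have fA: "finite A" using A(1) by (simp add: greedy_set_def)
  have "P A x \<noteq> x"
    using big mult_right_mono[OF C(1) qnorm_nonneg[of x]] by auto
  then have A0: "A \<subseteq> supp e' x"
    using greedy_zero_coord[OF A(1)] P_eq_self[OF fA] by (auto simp: supp_def)
  have "x \<noteq> 0" using \<open>P A x \<noteq> x\<close> P_eq_self[OF fA, of 0] by (auto simp: supp_def)
  then have xpos: "qnorm x > 0" by (rule qnorm_pos)
  have "s \<le> card A"
  proof (rule ccontr)
    assume "\<not> s \<le> card A"
    then have "qnorm (P A x) \<le> L * qnorm x"
      unfolding L_def using fA by (intro qnorm_P_le_qnorm) auto
    also have "\<dots> \<le> C * qnorm x" using C(2) qnorm_nonneg by (rule mult_right_mono)
    finally show False using big by simp
  qed
  then obtain R where R: "R \<subseteq> A" "card R = s" "greedy x (A - R)"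
    using greedy_removal[OF A(1)] by blast
  define A' where "A' = A - R"
  have fA': "finite A'" and fR: "finite R" using fA R(1) finite_subset by (auto simp: A'_def)
  have "P A x = P A' x + P R x"
    by (rule eq_if_coords_eq) (use fA fA' fR R(1) in \<open>auto simp: coord_add coord_P A'_def\<close>)
  then have "C * qnorm x \<le> \<kappa> * (qnorm (P A' x) + qnorm (P R x))"
    using big triangle[of "P A' x" "P R x"] by simp
  also have "\<dots> \<le> \<kappa> * (qnorm (P A' x) + L * qnorm x)"
    unfolding L_def using kappa_pos qnorm_P_le_qnorm[OF fR, of s x] R(2) by simp
  finally have "\<kappa> * (C1 + L) * qnorm x \<le> \<kappa> * (qnorm (P A' x) + L * qnorm x)"
    using mult_right_mono[OF C(3) qnorm_nonneg[of x]] by linarith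
  then have PA': "C1 * qnorm x \<le> qnorm (P A' x)"
    using kappa_pos by (simp add: distrib_right mult.assoc)
  define a where "a = \<eta> / qnorm x"
  have a: "a > 0" using \<eta>(1) xpos by (simp add: a_def)
  define y where "y = smul (of_real a) x"
  have "qnorm y = a * qnorm x" using a by (simp add: y_def qnorm_scale)
  then have qy: "qnorm y = \<eta>" using xpos by (simp add: a_def)
  have ycoord: "e' i y = of_real a * e' i x" for i by (simp add: y_def coord_scale)
  have y0: "e' i y = 0" if "i \<in> supp e' S" for i
    using m[OF that] x(2)[of i] by (auto simp: ycoord supp_def)
  have ySmall: "norm (e' j y) \<le> norm (e' i S)" if "i \<in> supp e' S" for i j
    using coord_le[of j y] qy \<eta>(3) \<beta>(2)[OF that] by simp
  define S' where "S' = S + y"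
  have S'S: "e' i S' = e' i S" if "i \<in> supp e' S" for i
    using y0[OF that] by (simp add: S'_def coord_add)
  have S'y: "e' i S' = e' i y" if "i \<notin> supp e' S" for i
    using that by (simp add: S'_def coord_add supp_def)
  define B where "B = supp e' S \<union> A'"
  have disj: "supp e' S \<inter> A' = {}"
    using m x(2) A0 by (fastforce simp: A'_def)
  have "supp e' S' \<subseteq> supp e' S \<union> supp e' x"
    by (auto simp: S'_def supp_def coord_add ycoord)
  then have fin: "finite (supp e' S')" using S x(1) finite_subset by blast
  have ext: "extends S S'"
    using S'S S'y ySmall by (simp add: extends_def)
  have BS': "B \<subseteq> supp e' S'"
  proof
    fix i assume "i \<in> B"
    then consider "i \<in> supp e' S" | "i \<in> A'" "i \<notin> supp e' S" by (auto simp: B_def)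
    then show "i \<in> supp e' S'"
    proof cases
      case 1
      then show ?thesis using S'S by (simp add: supp_def)
    next
      case 2
      then have "i \<in> supp e' x" using A0 by (auto simp: A'_def)
      then show ?thesis using S'y[OF 2(2)] a by (simp add: supp_def ycoord)
    qed
  qed
  have greedy: "greedy S' B"
    unfolding greedy_set_def
  proof (intro conjI ballI allI impI)
    show "finite B" using S fA' by (simp add: B_def)
    fix i j assume i: "i \<in> B" and "j \<notin> B"
    then have j: "j \<notin> supp e' S" "j \<notin> A'" by (auto simp: B_def)
    show "t * norm (e' j S') \<le> norm (e' i S')"
    proof (cases "i \<in> supp e' S")
      case True
      then show ?thesis using S'S S'y[OF j(1)] ySmall by (auto intro: scale_t_le)
    next
      case False
      then have "i \<in> A'" using i by (simp add: B_def)
      then have "t * norm (e' j x) \<le> norm (e' i x)"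
        using R(3) j(2) unfolding greedy_set_def A'_def[symmetric] by blast
      then have "a * (t * norm (e' j x)) \<le> a * norm (e' i x)"
        using a by simp
      then show ?thesis
        using S'y[OF False] S'y[OF j(1)] a by (simp add: ycoord norm_mult mult.left_commute)
    qed
  qed
  have "card B = s + (card A - s)"
    unfolding B_def s_def using card_Un_disjoint[OF S fA' disj] R(1,2) fR
    by (simp add: A'_def card_Diff_subset s_def)
  then have cB: "card B \<in> range n" using \<open>s \<le> card A\<close> A(2) by simp
  have "P B S' = S + P A' y"
  proof (rule eq_if_coords_eq)
    fix i
    show "e' i (P B S') = e' i (S + P A' y)"
    proof (cases "i \<in> supp e' S")
      case True
      then have "i \<notin> A'" using disj by blast
      then show ?thesis using True S fA' S'S by (simp add: B_def coord_P coord_add)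
    next
      case False
      then have "e' i S = 0" by (simp add: supp_def)
      then show ?thesis using False S fA' S'y by (simp add: B_def coord_P coord_add)
    qed
  qed
  then have "P A' y = P B S' - S" by simp
  then have "qnorm (P A' y) \<le> \<kappa> * (qnorm (P B S') + qnorm S)" using triangle_diff by simp
  moreover have "\<kappa> * (M + qnorm S) \<le> qnorm (P A' y)"
  proof -
    have "\<kappa> * (M + qnorm S) = a * (C1 * qnorm x)"
      using xpos \<eta>(1) by (simp add: a_def C1_def)
    also have "\<dots> \<le> a * qnorm (P A' x)" using PA' a by simp
    also have "\<dots> = qnorm (P A' y)"
      unfolding y_def P_scale[OF fA'] using a by (simp add: qnorm_scale)
    finally show ?thesis .
  qed
  ultimately have "\<kappa> * (M + qnorm S) \<le> \<kappa> * (qnorm (P B S') + qnorm S)" by linarith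
  then have "M \<le> qnorm (P B S')" using kappa_pos by simp
  then show ?thesis
    using fin ext BS' greedy cB qy \<eta>(2) by (intro exI[of _ S']) (auto simp: S'_def)
qed

lemma geometric_convergent:
  assumes step: "\<And>j. qnorm (X (Suc j) - X j) \<le> (1 / (2 * \<kappa>)) ^ Suc j"
  obtains x where "(\<lambda>k. qnorm (X k - x)) \<longlonglongrightarrow> 0"
proof -
  define r where "r = 1 / (2 * \<kappa>)"
  have r: "0 < r" "r < 1" "\<kappa> * r = 1 / 2" using kappa by (simp_all add: r_def)
  \<comment> \<open>Splitting off the first increment lets the rest start at \<open>Suc j\<close>,
    where the bound is smaller by the factor \<open>r\<close>; since
    \<open>2 * \<kappa> * r = 1\<close>, the quasi-triangle constants do not accumulate.\<close>
  have tail: "qnorm (X (j + p) - X j) \<le> r ^ j" for p j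
  proof (induction p arbitrary: j)
    case 0
    show ?case using r(1) by simp
  next
    case (Suc p)
    have "qnorm (X (j + Suc p) - X j) \<le>
        \<kappa> * (qnorm (X (Suc j + p) - X (Suc j)) + qnorm (X (Suc j) - X j))"
      using triangle[of "X (Suc j + p) - X (Suc j)" "X (Suc j) - X j"] by simp
    also have "\<dots> \<le> \<kappa> * (r ^ Suc j + r ^ Suc j)"
      using Suc.IH[of "Suc j"] step[of j] kappa_pos
      by (intro mult_left_mono add_mono) (auto simp: r_def)
    also have "\<dots> = 2 * (\<kappa> * r) * r ^ j" by simp
    also have "\<dots> = r ^ j" using r(3) by simp
    finally show ?case .
  qed
  have "\<exists>x. limitin (qnorm_topology qnorm) X x sequentially"
  proof (rule complete, intro allI impI)
    fix \<epsilon> :: real assume \<epsilon>: "\<epsilon> > 0"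
    obtain N where N: "r ^ N < \<epsilon> / (2 * \<kappa>)"
      using real_arch_pow_inv[of "\<epsilon> / (2 * \<kappa>)" r] r(2) \<epsilon> kappa_pos by auto
    have tail_N: "qnorm (X k - X N) \<le> r ^ N" if "k \<ge> N" for k
      using tail[of N "k - N"] that by simp
    have "qnorm (X k - X l) < \<epsilon>" if "k \<ge> N" "l \<ge> N" for k l
    proof -
      have "qnorm (X k - X l) \<le> \<kappa> * (qnorm (X k - X N) + qnorm (X l - X N))"
        using triangle_diff[of "X k - X N" "X l - X N"] by simp
      also have "\<dots> \<le> \<kappa> * (r ^ N + r ^ N)"
        using tail_N that kappa_pos by (intro mult_left_mono add_mono) auto
      also have "\<dots> < \<epsilon>" using N kappa_pos by (simp add: field_simps)
      finally show ?thesis .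
    qed
    then show "\<exists>M. \<forall>m\<ge>M. \<forall>n\<ge>M. qnorm (X m - X n) < \<epsilon>" by blast
  qed
  then show ?thesis using that limitin_qnorm_topology by blast
qed

lemma greedy_sums_bounded_imp_tail_bounded:
  assumes bdd: "\<And>x. \<exists>C>0. \<forall>A. greedy x A \<and> card A \<in> range n \<longrightarrow> qnorm (P A x) \<le> C"
  shows "\<exists>m. \<exists>C>0. greedy_bounded_on {x. finite (supp e' x) \<and> (\<forall>j\<in>supp e' x. m < j)} C"
proof (rule ccontr)
  assume "\<not> ?thesis"
  then have unbdd: "\<And>m C. C > 0 \<Longrightarrow>
      \<not> greedy_bounded_on {x. finite (supp e' x) \<and> (\<forall>j\<in>supp e' x. m < j)} C" by blast
  have "\<exists>X. \<forall>j. finite (supp e' (X j)) \<and> extends (X j) (X (Suc j)) \<and>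
      qnorm (X (Suc j) - X j) \<le> (1 / (2 * \<kappa>)) ^ Suc j \<and>
      (\<exists>B\<subseteq>supp e' (X (Suc j)). greedy (X (Suc j)) B \<and> card B \<in> range n \<and>
         qnorm (P B (X (Suc j))) \<ge> real j)"
  \<comment> \<open>The construction starts from \<open>0\<close>; stage \<open>j\<close> takes
    \<open>real j\<close> for \<open>M\<close> and the geometric bound for
    \<open>\<epsilon>\<close>.\<close>
  proof (rule dependent_nat_choice)
    show "\<exists>S. finite (supp e' S)" by (intro exI[of _ 0]) (simp add: supp_def)
  qed (rule hump_step[OF unbdd], use kappa_pos in auto)
  then obtain X where ext: "\<And>j. extends (X j) (X (Suc j))"
    and close: "\<And>j. qnorm (X (Suc j) - X j) \<le> (1 / (2 * \<kappa>)) ^ Suc j"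
    and hump: "\<And>j. \<exists>B\<subseteq>supp e' (X (Suc j)). greedy (X (Suc j)) B \<and> card B \<in> range n \<and>
         qnorm (P B (X (Suc j))) \<ge> real j"
    by blast
  obtain x where x: "(\<lambda>k. qnorm (X k - x)) \<longlonglongrightarrow> 0"
    using geometric_convergent[OF close] .
  have "extends (X j) (X k)" if "j \<le> k" for j k
    using that by (rule dec_induct) (auto intro: extends_refl extends_trans ext)
  then have extx: "extends (X j) x" for j using extends_limit x by blast
  obtain C where C: "\<And>A. greedy x A \<Longrightarrow> card A \<in> range n \<Longrightarrow> qnorm (P A x) \<le> C"
    using bdd[of x] by blast
  obtain j :: nat where j: "C < real j" using reals_Archimedean2 by blast
  obtain B where B: "B \<subseteq> supp e' (X (Suc j))" "greedy (X (Suc j)) B" "card B \<in> range n"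
    "qnorm (P B (X (Suc j))) \<ge> real j"
    using hump by blast
  have eq: "e' i x = e' i (X (Suc j))" if "i \<in> supp e' (X (Suc j))" for i
    using extx[of "Suc j"] that by (simp add: extends_def)
  \<comment> \<open>Inside the support of the stage the coordinates of \<open>x\<close> are
    unchanged; outside it \<open>extends\<close> makes them no larger than any on
    \<open>B\<close>.\<close>
  have "t * norm (e' l x) \<le> norm (e' i x)" if i: "i \<in> B" and l: "l \<notin> B" for i l
  proof (cases "l \<in> supp e' (X (Suc j))")
    case True
    then show ?thesis using eq i l B(1,2) unfolding greedy_set_def by (auto simp: subset_iff)
  next
    case False
    then have "norm (e' l x) \<le> norm (e' i x)"
      using extx[of "Suc j"] i B(1) eq by (auto simp: extends_def)
    then show ?thesis by (rule scale_t_le)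
  qed
  then have "greedy x B" using B(2) unfolding greedy_set_def by blast
  moreover have "P B x = P B (X (Suc j))"
    unfolding coord_proj_def using eq B(1) by (intro sum.cong) auto
  ultimately show False using C[of B] B(3,4) j by simp
qed

end

section \<open>Choice of constants and the equivalences\<close>

lemma (in semi_normalized_M_basis) greedy_M_basis_exists:
  assumes "0 < t" "t \<le> 1" "strict_mono n"
  obtains \<kappa> c where "greedy_M_basis smul qnorm e e' \<kappa> c t n"
proof -
  obtain \<kappa> where \<kappa>: "\<kappa> \<ge> 1" "\<And>x y. qnorm (x + y) \<le> \<kappa> * (qnorm x + qnorm y)"
    using quasi_triangle by blast
  obtain b where b: "\<And>i. qnorm (e i) \<le> b" using basis_bounded by (auto simp: bdd_above_def)
  obtain d where d: "\<And>i. dual_qnorm qnorm (e' i) \<le> d" using coord_bounded by (auto simp: bdd_above_def)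
  define c where "c = max 1 (max b d)"
  have c: "c \<ge> 1" "c \<ge> b" "c \<ge> d" by (auto simp: c_def)
  have "norm (e' i x) \<le> c * qnorm x" for i x
  proof -
    have "norm (e' i x) \<le> dual_qnorm qnorm (e' i) * qnorm x"
      by (rule norm_le_dual_qnorm[OF coord_linear coord_continuous])
    also have "\<dots> \<le> c * qnorm x"
      using order_trans[OF d c(3)] qnorm_nonneg by (rule mult_right_mono)
    finally show ?thesis .
  qed
  then have "greedy_M_basis smul qnorm e e' \<kappa> c t n"
    using \<kappa> assms c order_trans[OF b c(2)] by unfold_locales auto
  then show ?thesis by (rule that)
qed

theorem theorem7p4:
  fixes smul :: "'k::real_normed_field \<Rightarrow> 'a::ab_group_add \<Rightarrow> 'a"
    and qnorm :: "'a \<Rightarrow> real"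
    and e :: "nat \<Rightarrow> 'a"
    and e' :: "nat \<Rightarrow> 'a \<Rightarrow> 'k"
    and t :: real
    and n :: "nat \<Rightarrow> nat"
  assumes basis: "semi_normalized_M_basis smul qnorm e e'"
    and t: "0 < t" "t \<le> 1"
    and n: "strict_mono n" "\<And>k. 0 < n k"
  shows "let
      i = (\<exists>C1>0. \<forall>x A. greedy_set e' t x A \<and> card A \<in> range n \<longrightarrow>
             qnorm (coord_proj smul e e' A x) \<le> C1 * qnorm x);
      ii = (\<exists>C2>0. \<forall>x A. finite (supp e' x) \<and> greedy_set e' t x A \<and> card A \<in> range n \<longrightarrow>
             qnorm (coord_proj smul e e' A x) \<le> C2 * qnorm x);
      iii = (\<exists>m::nat. \<exists>C3>0. \<forall>x A. finite (supp e' x) \<and> (\<forall>j\<in>supp e' x. m < j) \<and>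
             greedy_set e' t x A \<and> card A \<in> range n \<longrightarrow>
             qnorm (coord_proj smul e e' A x) \<le> C3 * qnorm x);
      iv = (\<forall>x. \<exists>C4>0. \<forall>A. greedy_set e' t x A \<and> card A \<in> range n \<longrightarrow>
             qnorm (coord_proj smul e e' A x) \<le> C4);
      v = (\<forall>x G. (\<forall>k. greedy_sum smul e e' t (n k) x (G k)) \<longrightarrow>
             limitin (qnorm_topology qnorm) G x sequentially)
    in (i \<longleftrightarrow> ii) \<and> (i \<longleftrightarrow> iii) \<and> (i \<longleftrightarrow> iv) \<and> (i \<longleftrightarrow> v)"
proof -
  interpret semi_normalized_M_basis smul qnorm e e' by (rule basis)
  obtain \<kappa> c where "greedy_M_basis smul qnorm e e' \<kappa> c t n"
    using greedy_M_basis_exists[OF t n(1)] .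
  then interpret greedy_M_basis smul qnorm e e' \<kappa> c t n .
  define i where "i \<longleftrightarrow> (\<exists>C>0. greedy_bounded_on UNIV C)"
  define ii where "ii \<longleftrightarrow> (\<exists>C>0. greedy_bounded_on {x. finite (supp e' x)} C)"
  define iii where "iii \<longleftrightarrow>
    (\<exists>m. \<exists>C>0. greedy_bounded_on {x. finite (supp e' x) \<and> (\<forall>j\<in>supp e' x. m < j)} C)"
  define iv where "iv \<longleftrightarrow> (\<forall>x. \<exists>C>0. \<forall>A. greedy x A \<and> card A \<in> range n \<longrightarrow> qnorm (P A x) \<le> C)"
  define v where "v \<longleftrightarrow> (\<forall>x G. (\<forall>k. greedy_sum smul e e' t (n k) x (G k)) \<longrightarrow>
    limitin (qnorm_topology qnorm) G x sequentially)"
  \<comment> \<open>These two only shrink the class of vectors; the substantial implications run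
    through the cycle \<open>i\<close>, \<open>v\<close>, \<open>iv\<close>, \<open>iii\<close>,
    \<open>ii\<close>, \<open>i\<close>.\<close>
  have "i \<Longrightarrow> ii" "ii \<Longrightarrow> iii"
    unfolding i_def ii_def iii_def greedy_bounded_on_def by blast+
  moreover have "iii \<Longrightarrow> ii"
    unfolding ii_def iii_def using greedy_bounded_tail_imp_finite_supp by blast
  moreover have "ii \<Longrightarrow> i"
    unfolding i_def ii_def using greedy_bounded_finite_supp_imp_all by blast
  moreover have "i \<Longrightarrow> v"
    unfolding i_def v_def limitin_qnorm_topology using greedy_bounded_imp_convergent by blast
  moreover have "v \<Longrightarrow> iv"
    unfolding v_def iv_def limitin_qnorm_topology using convergent_imp_greedy_sums_bounded by blast
  moreover have "iv \<Longrightarrow> iii"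
    unfolding iv_def iii_def using greedy_sums_bounded_imp_tail_bounded by blast
  ultimately have "(i \<longleftrightarrow> ii) \<and> (i \<longleftrightarrow> iii) \<and> (i \<longleftrightarrow> iv) \<and> (i \<longleftrightarrow> v)" by blast
  from this[unfolded i_def ii_def iii_def iv_def v_def greedy_bounded_on_def
      mem_Collect_eq eqTrueI[OF UNIV_I] simp_thms conj_assoc]
  show ?thesis unfolding Let_def .
qed

end
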